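(* Let $M$ be a set system on $[n]$. Then $M$ is a strong $\Delta$-matroid if and only if it has no peerless antipode in any $k$-cube for $k\ge3$.
   Context: A set system on $[n]=\{1,\dots,n\}$ is a (possibly empty) collection of subsets of $[n]$; $\triangle$ is symmetric difference (when $a=b$, $\{a,b\}=\{a\}$). A $\Delta$-matroid is a set system $M$ such that for all $A,B\in M$ and $a\in A\triangle B$ there exists $b\in A\triangle B$ (possibly $b=a$) with $A\triangle\{a,b\}\in M$. A $\Delta$-matroid $M$ is strong if it satisfies the hyperplane exchange property: for all distinct $A,B\in M$ there exist (possibly equal) $a,b\in A\triangle B$ such that $A\triangle\{a,b\}\in M$ and $B\triangle\{a,b\}\in M$. For $S\subseteq[n]$ let $\varepsilon_S\in\mathbb R^n$ be its indicator vector. For $I,J\subseteq[n]$ let $\square_{I,J}=\operatorname{conv}\{\varepsilon_S: I\cap J\subseteq S\subseteq I\cup J\}$; it is a $k$-cube when $|I\triangle J|=k$. An antipode of $\square_{I,J}$ is a pair $(S,T)$ with $S\cap T=I\cap J$ and $S\triangle T=I\triangle J$. For $I,J\in M$, $(I,J)$ is a peerless antipode of $M$ in $\square_{I,J}$ if whenever $S,T\in M$ satisfy $S\cap T=I\cap J$ and $S\triangle T=I\triangle J$, then $\{S,T\}=\{I,J\}$. "$M$ has a peerless antipode in a $k$-cube" means there are $I,J\in M$ with $|I\triangle J|=k$ such that $(I,J)$ is a peerless antipode of $M$ in $\square_{I,J}$. *)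

theory Defs
  imports Main
begin

definition set_system :: "nat \<Rightarrow> nat set set \<Rightarrow> bool" where
  "set_system n M \<longleftrightarrow> M \<subseteq> Pow {1..n}"

definition delta_matroid :: "nat \<Rightarrow> nat set set \<Rightarrow> bool" where
  "delta_matroid n M \<longleftrightarrow> set_system n M \<and>
     (\<forall>A\<in>M. \<forall>B\<in>M. \<forall>a\<in>sym_diff A B. \<exists>b\<in>sym_diff A B. sym_diff A {a, b} \<in> M)"

definition hyperplane_exchange :: "nat set set \<Rightarrow> bool" where
  "hyperplane_exchange M \<longleftrightarrow>
     (\<forall>A\<in>M. \<forall>B\<in>M. A \<noteq> B \<longrightarrow>
        (\<exists>a\<in>sym_diff A B. \<exists>b\<in>sym_diff A B.
           sym_diff A {a, b} \<in> M \<and> sym_diff B {a, b} \<in> M))"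

definition strong_delta_matroid :: "nat \<Rightarrow> nat set set \<Rightarrow> bool" where
  "strong_delta_matroid n M \<longleftrightarrow> delta_matroid n M \<and> hyperplane_exchange M"

text \<open>
  The cube spanned by \<open>I\<close> and \<open>J\<close> is the convex hull of the indicator vectors of the sets
  between \<open>I \<inter> J\<close> and \<open>I \<union> J\<close>; its dimension is \<open>card (sym_diff I J)\<close>. It is represented here
  by the pair \<open>(I, J)\<close>: an antipode is the pair of sets labelling two opposite vertices.
\<close>

definition antipode :: "nat set \<Rightarrow> nat set \<Rightarrow> nat set \<Rightarrow> nat set \<Rightarrow> bool" where
  "antipode I J S T \<longleftrightarrow> S \<inter> T = I \<inter> J \<and> sym_diff S T = sym_diff I J"

definition peerless_antipode :: "nat set set \<Rightarrow> nat set \<Rightarrow> nat set \<Rightarrow> bool" where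
  "peerless_antipode M I J \<longleftrightarrow> I \<in> M \<and> J \<in> M \<and>
     (\<forall>S\<in>M. \<forall>T\<in>M. antipode I J S T \<longrightarrow> {S, T} = {I, J})"

definition has_peerless_antipode_in_cube :: "nat set set \<Rightarrow> nat \<Rightarrow> bool" where
  "has_peerless_antipode_in_cube M k \<longleftrightarrow>
     (\<exists>I\<in>M. \<exists>J\<in>M. card (sym_diff I J) = k \<and> peerless_antipode M I J)"

end

theory Submission
  imports Defs
begin

text \<open>
  Adding the spare element \<open>0\<close> to the members of odd cardinality turns \<open>M\<close> into a family
  all of whose members are even. A nontrivial antipode of the cube spanned by \<open>A\<close> and \<open>B\<close>
  yields members that are closer to \<open>A\<close> than \<open>B\<close> is, so induction on the distance shows that the
  extended family is an even \<open>\<Delta>\<close>-matroid. Even \<open>\<Delta>\<close>-matroids satisfy the simultaneous exchange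
  property: if the fundamental circuits of \<open>a\<close> at \<open>A\<close> and at \<open>B\<close> met only in \<open>a\<close>, then the rank of
  the union of the circuits without \<open>a\<close> would go up neither on adding \<open>a\<close> nor on adding its
  complementary element, which is absurd. Deleting \<open>0\<close> again gives the strong \<open>\<Delta>\<close>-matroid
  property of \<open>M\<close>.
\<close>

section \<open>Even exchange and agreement with a target set\<close>

text \<open>Since \<open>b\<close> differs from \<open>a\<close>, an exchange toggles exactly two
  elements. For finite members this is the axiom of even \<open>\<Delta>\<close>-matroids and forces
  equal parity of all cardinalities.\<close>

definition even_exchange :: "'a set set \<Rightarrow> bool" where
  "even_exchange F \<longleftrightarrow>
     (\<forall>A\<in>F. \<forall>B\<in>F. \<forall>a\<in>sym_diff A B. \<exists>b\<in>sym_diff A B. b \<noteq> a \<and> sym_diff A {a, b} \<in> F)"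

lemma even_exchangeE:
  assumes "even_exchange F" "A \<in> F" "B \<in> F" "a \<in> sym_diff A B"
  obtains b where "b \<in> sym_diff A B" "b \<noteq> a" "sym_diff A {a, b} \<in> F"
  using assms unfolding even_exchange_def by meson

text \<open>Two sets in the interval differ only inside \<open>sym_diff A B\<close>, so toggling
  such positions does not leave it. Restricting to the interval keeps exchange partners in
  \<open>sym_diff A B\<close>.\<close>

lemma even_exchange_between:
  assumes "even_exchange F"
  shows "even_exchange {X \<in> F. A \<inter> B \<subseteq> X \<and> X \<subseteq> A \<union> B}"
  unfolding even_exchange_def
proof (intro ballI)
  fix X Y a
  assume X: "X \<in> {X \<in> F. A \<inter> B \<subseteq> X \<and> X \<subseteq> A \<union> B}" and Y: "Y \<in> {X \<in> F. A \<inter> B \<subseteq> X \<and> X \<subseteq> A \<union> B}"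
    and a: "a \<in> sym_diff X Y"
  then obtain b where b: "b \<in> sym_diff X Y" "b \<noteq> a" "sym_diff X {a, b} \<in> F"
    using even_exchangeE[OF assms, of X Y a] by blast
  moreover have "A \<inter> B \<subseteq> sym_diff X {a, b}" "sym_diff X {a, b} \<subseteq> A \<union> B"
    using X Y a b(1) by auto
  ultimately show "\<exists>b\<in>sym_diff X Y. b \<noteq> a \<and>
      sym_diff X {a, b} \<in> {X \<in> F. A \<inter> B \<subseteq> X \<and> X \<subseteq> A \<union> B}"
    by blast
qed

lemma sym_diff_toggle_psubset:
  assumes "a \<in> sym_diff B A" "b \<in> sym_diff B A"
  shows "sym_diff A (sym_diff B {a, b}) \<subset> sym_diff A B"
proof
  show "sym_diff A (sym_diff B {a, b}) \<subseteq> sym_diff A B"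
    using assms by auto
  have "a \<in> sym_diff A B" "a \<notin> sym_diff A (sym_diff B {a, b})"
    using assms by auto
  then show "sym_diff A (sym_diff B {a, b}) \<noteq> sym_diff A B" by metis
qed

text \<open>
  The sets of positions at which a member can agree with \<open>T\<close> are the independent sets of a
  matroid; this is the extension of the independent set \<open>W\<close> to a basis of \<open>U\<close>.
\<close>

lemma extend_agreement:
  assumes F: "even_exchange F" and fin: "\<And>X. X \<in> F \<Longrightarrow> finite X"
    and U: "finite U" "W \<subseteq> U"
    and X0: "X0 \<in> F" "W \<inter> sym_diff X0 T = {}"
  obtains X where "X \<in> F" "W \<inter> sym_diff X T = {}"
    "\<And>Y. Y \<in> F \<Longrightarrow> card (U \<inter> sym_diff X T) \<le> card (U \<inter> sym_diff Y T)"
proof -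
  define dis where "dis X = card (U \<inter> sym_diff X T)" for X
  obtain X where X: "X \<in> F" "W \<inter> sym_diff X T = {}"
    and Xmin: "\<And>Z. Z \<in> F \<Longrightarrow> W \<inter> sym_diff Z T = {} \<Longrightarrow> dis X \<le> dis Z"
    using ex_has_least_nat[of "\<lambda>X. X \<in> F \<and> W \<inter> sym_diff X T = {}" X0 dis] X0 by blast
  \<comment> \<open>As for greedy bases in a matroid, the minimum under the constraint on
    \<open>W\<close> is already a minimum over all of \<open>F\<close>. Otherwise a better member
    nearest to \<open>X\<close> is examined.\<close>
  have "dis X \<le> dis Y" if "Y \<in> F" for Y
  proof (rule ccontr)
    assume "\<not> dis X \<le> dis Y"
    then have "Y \<in> F \<and> dis Y < dis X" using that by simp
    from ex_has_least_nat[of "\<lambda>Y. Y \<in> F \<and> dis Y < dis X", OF this, of "\<lambda>Y. card (sym_diff X Y)"]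
    obtain Y where Y: "Y \<in> F" "dis Y < dis X"
      and Ymin: "\<And>Z. Z \<in> F \<Longrightarrow> dis Z < dis X \<Longrightarrow> card (sym_diff X Y) \<le> card (sym_diff X Z)"
      by blast
    have finXY: "finite (sym_diff X Y)" using X Y fin by auto
    \<comment> \<open>A position of \<open>U\<close> where only \<open>Y\<close> disagrees with
      \<open>T\<close> could be repaired: the partner \<open>g\<close> adds at most one
      disagreement, so \<open>Y\<close> would stay better than \<open>X\<close> and move closer to
      it.\<close>
    have sub: "U \<inter> sym_diff Y T \<subseteq> sym_diff X T"
    proof (rule ccontr)
      assume "\<not> ?thesis"
      then obtain f where f: "f \<in> U" "f \<in> sym_diff Y T" "f \<notin> sym_diff X T" by blast
      then have "f \<in> sym_diff Y X" by blast
      then obtain g where g: "g \<in> sym_diff Y X" "g \<noteq> f" "sym_diff Y {f, g} \<in> F"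
        using even_exchangeE[OF F] X(1) Y(1) by metis
      have "U \<inter> sym_diff (sym_diff Y {f, g}) T \<subseteq> insert g (U \<inter> sym_diff Y T - {f})"
        using f by blast
      then have "dis (sym_diff Y {f, g}) \<le> card (insert g (U \<inter> sym_diff Y T - {f}))"
        unfolding dis_def using U by (intro card_mono) auto
      also have "\<dots> \<le> Suc (card (U \<inter> sym_diff Y T - {f}))"
        by (simp add: U(1) card_insert_if)
      also have "\<dots> = dis Y"
        unfolding dis_def using f U(1) by (intro card_Suc_Diff1) auto
      finally have "dis (sym_diff Y {f, g}) < dis X" using Y(2) by simp
      then have "card (sym_diff X Y) \<le> card (sym_diff X (sym_diff Y {f, g}))"
        by (rule Ymin[OF g(3)])
      moreover have "card (sym_diff X (sym_diff Y {f, g})) < card (sym_diff X Y)"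
        using finXY sym_diff_toggle_psubset[OF \<open>f \<in> sym_diff Y X\<close> g(1)]
        by (rule psubset_card_mono)
      ultimately show False by (meson not_le)
    qed
    have "\<not> U \<inter> sym_diff X T \<subseteq> U \<inter> sym_diff Y T"
      using Y(2) card_mono[of "U \<inter> sym_diff Y T" "U \<inter> sym_diff X T"] U(1)
      unfolding dis_def by auto
    then obtain e where e: "e \<in> U" "e \<in> sym_diff X T" "e \<notin> sym_diff Y T" by blast
    then have "e \<in> sym_diff X Y" by blast
    then obtain f where f: "f \<in> sym_diff X Y" "f \<noteq> e" "sym_diff X {e, f} \<in> F"
      using even_exchangeE[OF F] X(1) Y(1) by metis
    \<comment> \<open>By \<open>sub\<close>, if \<open>f\<close> lies in \<open>U\<close> then
      \<open>X\<close> disagrees with \<open>T\<close> at \<open>f\<close>, so toggling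
      \<open>f\<close> creates no new disagreement in \<open>U\<close>.\<close>
    have *: "U \<inter> sym_diff (sym_diff X {e, f}) T \<subset> U \<inter> sym_diff X T"
      using e f(1) sub by blast
    then have "dis (sym_diff X {e, f}) < dis X"
      unfolding dis_def using U(1) by (intro psubset_card_mono) auto
    moreover have "W \<inter> sym_diff (sym_diff X {e, f}) T = {}"
      using * X(2) U(2) by blast
    ultimately show False using Xmin[OF f(3)] by simp
  qed
  then show thesis using that X unfolding dis_def by blast
qed

section \<open>Simultaneous exchange\<close>

lemma simultaneous_exchange:
  assumes "even_exchange F" and "\<And>X. X \<in> F \<Longrightarrow> finite X"
    and AB: "A \<in> F" "B \<in> F" and a: "a \<in> sym_diff A B"
  obtains b where "b \<in> sym_diff A B" "b \<noteq> a" "sym_diff A {a, b} \<in> F" "sym_diff B {a, b} \<in> F"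
proof (rule ccontr)
  assume none: "\<not> thesis"
  define D where "D = sym_diff A B"
  define G where "G = {X \<in> F. A \<inter> B \<subseteq> X \<and> X \<subseteq> A \<union> B}"
  \<comment> \<open>\<open>C\<close> and \<open>K\<close> are the fundamental circuits of
    \<open>a\<close> at \<open>A\<close> and at \<open>B\<close>, with \<open>a\<close>
    removed.\<close>
  define C where "C = {b \<in> D. b \<noteq> a \<and> sym_diff A {a, b} \<in> F}"
  define K where "K = {b \<in> D. b \<noteq> a \<and> sym_diff B {a, b} \<in> F}"
  \<comment> \<open>The target looks like \<open>B\<close> on \<open>insert a K\<close> and, once
    \<open>C\<close> and \<open>K\<close> are known to be disjoint, like \<open>A\<close> on
    \<open>C\<close>.\<close>
  define T where "T = sym_diff A (insert a K)"
  have G: "even_exchange G"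
    unfolding G_def using assms(1) by (rule even_exchange_between)
  have finG: "finite X" if "X \<in> G" for X
    using that assms(2) unfolding G_def by blast
  have AG: "A \<in> G" and BG: "B \<in> G" using AB unfolding G_def by auto
  have disj: "C \<inter> K = {}"
    using none that unfolding C_def K_def D_def by blast
  have "finite D" using AB assms(2) unfolding D_def by simp
  then have finCK: "finite C" "finite K" unfolding C_def K_def by simp_all
  have aD: "a \<in> D" "a \<notin> C" "a \<notin> K" using a unfolding C_def K_def D_def by auto
  have TA: "C \<inter> sym_diff X T = C \<inter> sym_diff X A" for X
    using disj aD unfolding T_def by blast
  have TB: "insert a K \<inter> sym_diff X T = insert a K \<inter> sym_diff X B" for X
    using aD unfolding T_def K_def D_def by blast
  \<comment> \<open>Moving \<open>A\<close> towards a member that differs at \<open>a\<close> needs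
    a partner of \<open>a\<close>, and all partners inside the interval lie in
    \<open>C\<close>.\<close>
  have fundA: "a \<notin> sym_diff X A" if X: "X \<in> G" "C \<inter> sym_diff X A = {}" for X
  proof
    assume "a \<in> sym_diff X A"
    then obtain b where "b \<in> sym_diff A X" "b \<noteq> a" "sym_diff A {a, b} \<in> G"
      using even_exchangeE[OF G AG X(1), of a] by blast
    then have "b \<in> C" using X(1) unfolding C_def D_def G_def by blast
    then show False using X(2) \<open>b \<in> sym_diff A X\<close> by blast
  qed
  have fundB: "a \<notin> sym_diff X B" if X: "X \<in> G" "K \<inter> sym_diff X B = {}" for X
  proof
    assume "a \<in> sym_diff X B"
    then obtain b where "b \<in> sym_diff B X" "b \<noteq> a" "sym_diff B {a, b} \<in> G"
      using even_exchangeE[OF G BG X(1), of a] by blast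
    then have "b \<in> K" using X(1) unfolding K_def D_def G_def by blast
    then show False using X(2) \<open>b \<in> sym_diff B X\<close> by blast
  qed
  have "K \<inter> sym_diff B T = {}" using TB[of B] by blast
  then obtain Y where Y: "Y \<in> G" "K \<inter> sym_diff Y T = {}"
    and Ymin: "\<And>Z. Z \<in> G \<Longrightarrow> card ((C \<union> K) \<inter> sym_diff Y T) \<le> card ((C \<union> K) \<inter> sym_diff Z T)"
    using extend_agreement[OF G finG, of "C \<union> K" K B T] finCK BG by blast
  have "C \<inter> sym_diff A T = {}" using TA[of A] by blast
  then obtain X where X: "X \<in> G" "C \<inter> sym_diff X T = {}"
    and Xmin: "\<And>Z. Z \<in> G \<Longrightarrow> card (insert a (C \<union> K) \<inter> sym_diff X T)
                  \<le> card (insert a (C \<union> K) \<inter> sym_diff Z T)"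
    using extend_agreement[OF G finG, of "insert a (C \<union> K)" C A T] finCK AG by blast
  \<comment> \<open>Counting \<open>a\<close> costs \<open>Y\<close> nothing, because
    \<open>T\<close> looks like \<open>B\<close> there, but costs \<open>X\<close> one disagreement.
    As \<open>Y\<close> is optimal on \<open>C \<union> K\<close>, it beats \<open>X\<close> on the
    larger set, where \<open>X\<close> was optimal.\<close>
  have "a \<notin> sym_diff Y T" using fundB[OF Y(1)] TB[of Y] Y(2) by blast
  then have "insert a (C \<union> K) \<inter> sym_diff Y T = (C \<union> K) \<inter> sym_diff Y T" by blast
  moreover have "a \<notin> sym_diff X A" using fundA[OF X(1)] TA[of X] X(2) by blast
  then have "a \<in> sym_diff X T" unfolding T_def by blast
  then have "insert a (C \<union> K) \<inter> sym_diff X T = insert a ((C \<union> K) \<inter> sym_diff X T)" by blast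
  then have "card (insert a (C \<union> K) \<inter> sym_diff X T) = Suc (card ((C \<union> K) \<inter> sym_diff X T))"
    using finCK aD by simp
  ultimately show False using Xmin[OF Y(1)] Ymin[OF X(1)] by simp
qed

section \<open>Parity extension and antipodes\<close>

definition parity_extension :: "nat set set \<Rightarrow> nat set set" where
  "parity_extension M = {S. S - {0} \<in> M \<and> finite S \<and> even (card S)}"

lemma even_card_sym_diff:
  assumes "finite A" "finite B"
  shows "even (card (sym_diff A B)) \<longleftrightarrow> (even (card A) \<longleftrightarrow> even (card B))"
proof -
  have "card (sym_diff A B) = card (A - B) + card (B - A)"
    using assms by (intro card_Un_disjoint) auto
  moreover have "card A = card (A - B) + card (A \<inter> B)" "card B = card (B - A) + card (A \<inter> B)"
    using assms card_Int_Diff[of A B] card_Int_Diff[of B A] by (simp_all add: Int_commute)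
  ultimately show ?thesis by presburger
qed

text \<open>Toggling \<open>0\<close> alone would change the parity, so an even set is determined by
  its part off \<open>0\<close>; hence lifts are unique.\<close>

lemma even_card_eqI:
  fixes A B :: "nat set"
  assumes "finite A" "finite B" "even (card A)" "even (card B)" "A - {0} = B - {0}"
  shows "A = B"
proof (rule ccontr)
  assume "A \<noteq> B"
  then have "sym_diff A B = {0}" using assms(5) by auto
  then show False using even_card_sym_diff[OF assms(1,2)] assms(3,4) by simp
qed

lemma parity_extension_sym_diff_doubleton:
  assumes "A \<in> parity_extension M" "a \<noteq> b" "sym_diff A {a, b} - {0} \<in> M"
  shows "sym_diff A {a, b} \<in> parity_extension M"
  using assms even_card_sym_diff[of A "{a, b}"] unfolding parity_extension_def by simp

lemma lift_to_parity_extension: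
  assumes "S \<in> M" "finite S" "0 \<notin> S"
  obtains S' where "S' \<in> parity_extension M" "S' - {0} = S"
proof (cases "even (card S)")
  case True
  then show ?thesis using that[of S] assms unfolding parity_extension_def by simp
next
  case False
  then show ?thesis using that[of "insert 0 S"] assms unfolding parity_extension_def by simp
qed

lemma even_exchange_parity_extension:
  assumes M: "M \<subseteq> Pow {1..n}"
    and peers: "\<forall>k\<ge>3. \<not> has_peerless_antipode_in_cube M k"
  shows "even_exchange (parity_extension M)"
proof -
  let ?E = "parity_extension M"
  have finM: "finite S" "0 \<notin> S" if "S \<in> M" for S
  proof -
    have "S \<subseteq> {1..n}" using M that by blast
    then show "finite S" "0 \<notin> S" using finite_subset by auto
  qed
  have "\<exists>b\<in>sym_diff A B. b \<noteq> a \<and> sym_diff A {a, b} \<in> ?E"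
    if "A \<in> ?E" "B \<in> ?E" "a \<in> sym_diff A B" for A B a
    using that
  proof (induction "card (sym_diff A B - {0})" arbitrary: A B a rule: less_induct)
    case less
    note A = less.prems(1) and B = less.prems(2) and a = less.prems(3)
    have fin: "finite A" "finite B" and ev: "even (card A)" "even (card B)"
      and AM: "A - {0} \<in> M" and BM: "B - {0} \<in> M"
      using A B unfolding parity_extension_def by auto
    have finD: "finite (sym_diff A B)" using fin by simp
    have evD: "even (card (sym_diff A B))" using even_card_sym_diff[OF fin] ev by simp
    have D0: "sym_diff (A - {0}) (B - {0}) = sym_diff A B - {0}" by blast
    show ?case
    proof (cases "card (sym_diff A B - {0}) \<ge> 3")
      \<comment> \<open>At most two differences off \<open>0\<close> leave at most three in all, and
        parity makes them exactly two: toggling both yields \<open>B\<close>.\<close>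
      case False
      have "card (sym_diff A B) \<le> Suc (card (sym_diff A B - {0}))"
        using card_Diff_singleton_if[of "sym_diff A B" 0] by (simp only: split: if_splits) linarith+
      then have "card (sym_diff A B) < 4" using False by linarith
      moreover have "card (sym_diff A B) \<noteq> 0" using a finD by auto
      moreover have "card (sym_diff A B) \<noteq> 1" "card (sym_diff A B) \<noteq> 3" using evD by auto
      ultimately have "card (sym_diff A B) = 2" by linarith
      then obtain b where b: "b \<noteq> a" "sym_diff A B = {a, b}"
        using a by (metis card_2_iff doubleton_eq_iff insert_iff singletonD)
      then have "sym_diff A {a, b} = B" by blast
      then show ?thesis using b B by (metis insertCI)
    next
      case True
      have "\<not> peerless_antipode M (A - {0}) (B - {0})"
        using peers True AM BM D0 unfolding has_peerless_antipode_in_cube_def by metis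
      then obtain S T where ST: "S \<in> M" "T \<in> M" "{S, T} \<noteq> {A - {0}, B - {0}}"
        and "antipode (A - {0}) (B - {0}) S T"
        using AM BM unfolding peerless_antipode_def by meson
      then have Int: "S \<inter> T = (A - {0}) \<inter> (B - {0})"
        and Diff: "sym_diff S T = sym_diff A B - {0}"
        unfolding antipode_def D0 by (simp_all only: simp_thms)
      \<comment> \<open>The induction hypothesis may return the partner \<open>0\<close> although
        \<open>A\<close> and \<open>B\<close> agree there. Then \<open>sym_diff A {a, 0}\<close> is
        closer to \<open>B\<close> off \<open>0\<close>, and exchanging \<open>0\<close> back
        towards \<open>B\<close> replaces it by a partner \<open>c\<close> in
        \<open>sym_diff A B\<close>.\<close>
      have step: ?thesis
        if "S' \<in> ?E" and "sym_diff A S' - {0} \<subset> sym_diff A B - {0}" and "a \<in> sym_diff A S'" for S'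
      proof -
        have "card (sym_diff A S' - {0}) < card (sym_diff A B - {0})"
          using that finD by (intro psubset_card_mono) auto
        from less.hyps[OF this A that(1,3)]
        obtain b where b: "b \<in> sym_diff A S'" "b \<noteq> a" "sym_diff A {a, b} \<in> ?E" by blast
        show ?thesis
        proof (cases "b \<in> sym_diff A B")
          case True
          then show ?thesis using b by blast
        next
          case False
          then have b0: "b = 0" "0 \<notin> sym_diff A B" using that(2) b(1) by blast+
          then have "a \<noteq> 0" using a by metis
          let ?A = "sym_diff A {a, 0}"
          have eq: "sym_diff ?A B = insert 0 (sym_diff A B - {a})"
            using a b0(2) \<open>a \<noteq> 0\<close> by blast
          have "sym_diff ?A B - {0} \<subset> sym_diff A B - {0}"
            unfolding eq using a \<open>a \<noteq> 0\<close> by blast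
          then have "card (sym_diff ?A B - {0}) < card (sym_diff A B - {0})"
            using finD by (intro psubset_card_mono) auto
          moreover have "?A \<in> ?E" using b(3) b0 by simp
          moreover have "0 \<in> sym_diff ?A B" unfolding eq by simp
          ultimately obtain c where c: "c \<in> sym_diff ?A B" "c \<noteq> 0" "sym_diff ?A {0, c} \<in> ?E"
            using less.hyps[of ?A B 0] B by blast
          have cD: "c \<in> sym_diff A B" "c \<noteq> a" using c(1,2) unfolding eq by auto
          have "sym_diff ?A {0, c} = sym_diff A {a, c}"
            using \<open>c \<noteq> 0\<close> \<open>c \<noteq> a\<close> \<open>a \<noteq> 0\<close> by blast
          then show ?thesis using cD c(3) by metis
        qed
      qed
      obtain S' T' where S': "S' \<in> ?E" "S' - {0} = S" and T': "T' \<in> ?E" "T' - {0} = T"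
        using lift_to_parity_extension ST(1,2) finM by metis
      have subS: "sym_diff A S' - {0} = sym_diff (A - {0}) S" 
        and subT: "sym_diff A T' - {0} = sym_diff (A - {0}) T" 
        using S' T' by blast+
      have "sym_diff (A - {0}) S \<subseteq> sym_diff A B - {0}" "sym_diff (A - {0}) T \<subseteq> sym_diff A B - {0}"
        using Int Diff by blast+
      \<comment> \<open>Differing from \<open>A\<close> on the whole cube would make
        \<open>S\<close> the opposite vertex, and the antipode the trivial one.\<close>
      moreover have "sym_diff (A - {0}) S \<noteq> sym_diff A B - {0}"
      proof
        assume "sym_diff (A - {0}) S = sym_diff A B - {0}"
        then have "S = B - {0}" "T = A - {0}" using ST(1,2) Int Diff finM by (blast+)
        then show False using ST(3) by blast
      qed
      moreover have "sym_diff (A - {0}) T \<noteq> sym_diff A B - {0}"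
      proof
        assume "sym_diff (A - {0}) T = sym_diff A B - {0}"
        then have "T = B - {0}" "S = A - {0}" using ST(1,2) Int Diff finM by (blast+)
        then show False using ST(3) by blast
      qed
      ultimately have *: "sym_diff A S' - {0} \<subset> sym_diff A B - {0}"
        "sym_diff A T' - {0} \<subset> sym_diff A B - {0}"
        unfolding subS subT by blast+
      have "finite S'" "finite T'" "even (card S')" "even (card T')"
        using S'(1) T'(1) unfolding parity_extension_def by auto
      then have "finite (sym_diff S' T')" "even (card (sym_diff S' T'))"
        using even_card_sym_diff by auto
      \<comment> \<open>Parity settles position \<open>0\<close>: the lifts differ exactly where
        \<open>A\<close> and \<open>B\<close> do, so one of them differs from \<open>A\<close> at
        \<open>a\<close>, even if \<open>a = 0\<close>.\<close>
      moreover have "sym_diff S' T' - {0} = sym_diff A B - {0}"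
        using Diff S'(2) T'(2) by blast
      ultimately have "sym_diff S' T' = sym_diff A B"
        using even_card_eqI finD evD by metis
      then have "a \<in> sym_diff A S' \<or> a \<in> sym_diff A T'" using a by blast
      then show ?thesis using step[OF S'(1) *(1)] step[OF T'(1) *(2)] by blast
    qed
  qed
  then show ?thesis unfolding even_exchange_def by blast
qed

section \<open>Strong \<open>\<Delta>\<close>-matroids\<close>

text \<open>Toggling the same positions of \<open>sym_diff I J\<close> in both sets gives another
  antipode. It moves \<open>I\<close>, so being peerless would force it to swap \<open>I\<close> and
  \<open>J\<close>, leaving at most two differences.\<close>

lemma hyperplane_exchange_no_peerless:
  assumes "hyperplane_exchange M" "k \<ge> 3"
  shows "\<not> has_peerless_antipode_in_cube M k"
proof
  assume "has_peerless_antipode_in_cube M k"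
  then obtain I J where IJ: "I \<in> M" "J \<in> M" "card (sym_diff I J) = k" "peerless_antipode M I J"
    unfolding has_peerless_antipode_in_cube_def by blast
  then have "I \<noteq> J" using assms(2) by auto
  then obtain a b where ab: "a \<in> sym_diff I J" "b \<in> sym_diff I J"
    "sym_diff I {a, b} \<in> M" "sym_diff J {a, b} \<in> M"
    using assms(1) IJ unfolding hyperplane_exchange_def by meson
  have "antipode I J (sym_diff I {a, b}) (sym_diff J {a, b})"
    unfolding antipode_def using ab(1,2) by auto
  then have "{sym_diff I {a, b}, sym_diff J {a, b}} = {I, J}"
    using IJ(4) ab(3,4) unfolding peerless_antipode_def by meson
  moreover have "sym_diff I {a, b} \<noteq> I" by blast
  ultimately have "J = sym_diff I {a, b}" by (metis doubleton_eq_iff)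
  then have "sym_diff I J \<subseteq> {a, b}" by auto
  then have "card (sym_diff I J) \<le> card {a, b}" by (intro card_mono) auto
  also have "\<dots> \<le> 2" by (simp add: card_insert_if)
  finally show False using IJ(3) assms(2) by simp
qed

text \<open>With \<open>a\<close> prescribed and both sets exchanged at once, this yields the
  \<open>\<Delta>\<close>-matroid axiom and hyperplane exchange together.\<close>

lemma no_peerless_simultaneous_exchange:
  assumes M: "M \<subseteq> Pow {1..n}"
    and peers: "\<forall>k\<ge>3. \<not> has_peerless_antipode_in_cube M k"
    and AB: "A \<in> M" "B \<in> M" and a: "a \<in> sym_diff A B"
  shows "\<exists>b\<in>sym_diff A B. sym_diff A {a, b} \<in> M \<and> sym_diff B {a, b} \<in> M"
proof -
  have finM: "finite S" "0 \<notin> S" if "S \<in> M" for S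
  proof -
    have "S \<subseteq> {1..n}" using M that by blast
    then show "finite S" "0 \<notin> S" using finite_subset by auto
  qed
  obtain A' where A': "A' \<in> parity_extension M" "A' - {0} = A"
    using lift_to_parity_extension AB(1) finM by metis
  obtain B' where B': "B' \<in> parity_extension M" "B' - {0} = B"
    using lift_to_parity_extension AB(2) finM by metis
  have D: "sym_diff A B = sym_diff A' B' - {0}"
    unfolding A'(2)[symmetric] B'(2)[symmetric] by blast
  then have a': "a \<in> sym_diff A' B' - {0}" using a by (simp only:)
  then have "a \<in> sym_diff A' B'" by (rule DiffD1)
  then obtain b where b: "b \<in> sym_diff A' B'" "b \<noteq> a"
    "sym_diff A' {a, b} \<in> parity_extension M" "sym_diff B' {a, b} \<in> parity_extension M"
    using simultaneous_exchange[OF even_exchange_parity_extension[OF M peers] _ A'(1) B'(1)]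
    unfolding parity_extension_def by blast
  \<comment> \<open>Toggling \<open>0\<close> along with \<open>a\<close> in the extension toggles
    \<open>a\<close> alone in \<open>M\<close>, so the partner \<open>0\<close> becomes
    \<open>a\<close> itself.\<close>
  define c where "c = (if b = 0 then a else b)"
  have "c \<in> sym_diff A' B' - {0}" using b(1) a' unfolding c_def by (cases "b = 0") simp_all
  then have "c \<in> sym_diff A B" unfolding D .
  moreover have "sym_diff A' {a, b} - {0} = sym_diff A {a, c}"
    "sym_diff B' {a, b} - {0} = sym_diff B {a, c}"
    unfolding c_def A'(2)[symmetric] B'(2)[symmetric] using a' by auto
  ultimately show ?thesis using b(3,4) unfolding parity_extension_def by auto
qed

theorem theorem3p13:
  fixes n :: nat and M :: "nat set set"
  assumes "set_system n M"
  shows "strong_delta_matroid n M \<longleftrightarrow> (\<forall>k\<ge>3. \<not> has_peerless_antipode_in_cube M k)"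
proof
  assume "strong_delta_matroid n M"
  then show "\<forall>k\<ge>3. \<not> has_peerless_antipode_in_cube M k"
    using hyperplane_exchange_no_peerless unfolding strong_delta_matroid_def by blast
next
  assume peers: "\<forall>k\<ge>3. \<not> has_peerless_antipode_in_cube M k"
  have M: "M \<subseteq> Pow {1..n}" using assms unfolding set_system_def .
  note exchange = no_peerless_simultaneous_exchange[OF M peers]
  have "delta_matroid n M"
    unfolding delta_matroid_def using assms exchange by meson
  moreover have "hyperplane_exchange M"
    unfolding hyperplane_exchange_def
  proof (intro ballI impI)
    fix A B assume "A \<in> M" "B \<in> M" "A \<noteq> B"
    moreover from \<open>A \<noteq> B\<close> obtain a where "a \<in> sym_diff A B" by blast
    ultimately show "\<exists>a\<in>sym_diff A B. \<exists>b\<in>sym_diff A B.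
        sym_diff A {a, b} \<in> M \<and> sym_diff B {a, b} \<in> M"
      using exchange by blast
  qed
  ultimately show "strong_delta_matroid n M"
    unfolding strong_delta_matroid_def by blast
qed

end
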